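(* Let $K=\mathbb{F}_q$ be a finite field with $q$ odd (i.e. $2\mid q-1$). Let $r\ge 1$ and, for $1\le i\le r$, let $m_i\geq 1$, $\gamma_i\ge 1$, $k_i=2\gamma_i+1$, and let $\mathcal{G}_i$ be a graph with $m_i$ connected components, each of which is a $k_i$-cycle. Let $\mathcal{G}=\bigcup_{i=1}^{r}\mathcal{G}_i$ be the disjoint union. Then $$G=\bigcup_{i=1}^{r}\{(t_{j}^{i})^{q-1}-1\}_{j=1}^{k_{i}m_{i}}\ \cup\ \bigcup_{i=1}^{r}\bigcup_{j=1}^{m_{i}}A_{j}^{i}$$ is a Gröbner basis for the vanishing ideal $\mathbf{I}(X_{\mathcal{G}}^{\ast})\subseteq K[t_j^i \mid 1\le i\le r,\ 1\le j\le k_im_i]$ with respect to the grlex (graded lexicographic) order.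
   Context: Write $K^\ast=K\setminus\{0\}$. Superscripts $i$ on variables are indices, not powers. The vertices of $\mathcal{G}_i$ are $x^i_1,\ldots,x^i_{k_im_i}$; for $1\le j\le m_i$ the $j$-th component of $\mathcal{G}_i$ is the cycle $x^i_{(j-1)k_i+1}x^i_{(j-1)k_i+2}\cdots x^i_{jk_i}x^i_{(j-1)k_i+1}$. The edges of $\mathcal G_i$ are numbered so that, for $(j-1)k_i+1\le l< jk_i$, the $l$-th edge is $\{x^i_l,x^i_{l+1}\}$, and the $jk_i$-th edge is $\{x^i_{jk_i},x^i_{(j-1)k_i+1}\}$; the variable $t^i_l$ corresponds to the $l$-th edge of $\mathcal{G}_i$. The affine algebraic toric set $X_{\mathcal{G}}^{\ast}$ is the set of all points (one coordinate per edge of $\mathcal{G}$) whose coordinate at an edge $\{u,v\}$ is the product $uv$, as the vertex variables range independently over all values in $K^\ast$. The vanishing ideal $\mathbf{I}(X)$ of a set $X$ of points is the ideal of all polynomials vanishing at every point of $X$. For $1\le i\le r$, $1\le j\le m_i$, let $A_j^i$ be the set of all binomials $$\prod_{\alpha\in B}(t^i_\alpha)^{\frac{q-1}{2}}-\prod_{w\in B^c}(t^i_w)^{\frac{q-1}{2}},$$ where $B$ ranges over the subsets of $\{(j-1)k_i+1,\ldots,jk_i\}$ with $|B|=\gamma_i$ and $B^c=\{(j-1)k_i+1,\ldots,jk_i\}\setminus B$. *)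

theory Defs
  imports "HOL-Algebra.Ideal" "HOL-Library.Poly_Mapping" "HOL-Library.FuncSet"
begin

section \<open>Multivariate polynomials\<close>

text \<open>A power product is a finitely supported exponent function, and a polynomial is a finitely
  supported function from power products to coefficients; multiplication of \<^type>\<open>poly_mapping\<close>
  is the convolution product. The variables used are restricted to an explicit set \<open>V\<close>,
  so that \<open>mpoly_ring V\<close> is the ring \<open>K[t\<^sub>v | v \<in> V]\<close>.\<close>

type_synonym ('v, 'a) mpol = "('v \<Rightarrow>\<^sub>0 nat) \<Rightarrow>\<^sub>0 'a"

definition Var :: "'v \<Rightarrow> ('v, 'a::comm_ring_1) mpol" where
  "Var v = Poly_Mapping.single (Poly_Mapping.single v 1) 1"

definition mpol_eval :: "('v \<Rightarrow> 'a) \<Rightarrow> ('v, 'a::comm_ring_1) mpol \<Rightarrow> 'a" where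
  "mpol_eval x f =
     (\<Sum>m\<in>Poly_Mapping.keys f. Poly_Mapping.lookup f m *
        (\<Prod>v\<in>Poly_Mapping.keys m. x v ^ Poly_Mapping.lookup m v))"

definition mpoly_ring :: "'v set \<Rightarrow> ('v, 'a::comm_ring_1) mpol ring" where
  "mpoly_ring V =
     \<lparr>carrier = {f. \<forall>m\<in>Poly_Mapping.keys f. Poly_Mapping.keys m \<subseteq> V},
      mult = (*), one = 1, zero = 0, add = (+)\<rparr>"

definition vanishing_ideal :: "'v set \<Rightarrow> ('v \<Rightarrow> 'a) set \<Rightarrow> ('v, 'a::comm_ring_1) mpol set" where
  "vanishing_ideal V X = {f \<in> carrier (mpoly_ring V). \<forall>p\<in>X. mpol_eval p f = 0}"


section \<open>Graded lexicographic order and Groebner bases\<close>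

definition total_deg :: "('v \<Rightarrow>\<^sub>0 nat) \<Rightarrow> nat" where
  "total_deg m = (\<Sum>v\<in>Poly_Mapping.keys m. Poly_Mapping.lookup m v)"

text \<open>\<open>ord\<close> is a (reflexive) linear order of the variables \<open>V\<close>; \<open>(v, u) \<in> ord\<close> means that the
  variable \<open>u\<close> is at least as large as \<open>v\<close>. Exponents of larger variables are compared first.\<close>

definition grlex_less :: "'v set \<Rightarrow> ('v \<times> 'v) set \<Rightarrow> ('v \<Rightarrow>\<^sub>0 nat) \<Rightarrow> ('v \<Rightarrow>\<^sub>0 nat) \<Rightarrow> bool" where
  "grlex_less V ord m m' \<longleftrightarrow>
     total_deg m < total_deg m' \<or>
     total_deg m = total_deg m' \<and>
       (\<exists>v\<in>V. Poly_Mapping.lookup m v < Poly_Mapping.lookup m' v \<and>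
          (\<forall>u\<in>V. (v, u) \<in> ord \<and> u \<noteq> v \<longrightarrow> Poly_Mapping.lookup m u = Poly_Mapping.lookup m' u))"

text \<open>The following two are only meaningful for nonzero \<open>f\<close>; \<open>lt\<close> is the strict monomial order.\<close>

definition lead_mon ::
  "(('v \<Rightarrow>\<^sub>0 nat) \<Rightarrow> ('v \<Rightarrow>\<^sub>0 nat) \<Rightarrow> bool) \<Rightarrow> ('v, 'a::comm_ring_1) mpol \<Rightarrow> ('v \<Rightarrow>\<^sub>0 nat)" where
  "lead_mon lt f =
     (THE m. m \<in> Poly_Mapping.keys f \<and> (\<forall>m'\<in>Poly_Mapping.keys f. m' \<noteq> m \<longrightarrow> lt m' m))"

definition lead_term ::
  "(('v \<Rightarrow>\<^sub>0 nat) \<Rightarrow> ('v \<Rightarrow>\<^sub>0 nat) \<Rightarrow> bool) \<Rightarrow> ('v, 'a::comm_ring_1) mpol \<Rightarrow> ('v, 'a) mpol" where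
  "lead_term lt f =
     Poly_Mapping.single (lead_mon lt f) (Poly_Mapping.lookup f (lead_mon lt f))"

definition groebner_basis ::
  "'v set \<Rightarrow> (('v \<Rightarrow>\<^sub>0 nat) \<Rightarrow> ('v \<Rightarrow>\<^sub>0 nat) \<Rightarrow> bool) \<Rightarrow>
     ('v, 'a::comm_ring_1) mpol set \<Rightarrow> ('v, 'a) mpol set \<Rightarrow> bool" where
  "groebner_basis V lt G I \<longleftrightarrow>
     ideal I (mpoly_ring V) \<and> finite G \<and> G \<subseteq> I \<and>
     Idl\<^bsub>mpoly_ring V\<^esub> (lead_term lt ` (G - {0})) =
     Idl\<^bsub>mpoly_ring V\<^esub> (lead_term lt ` (I - {0}))"


section \<open>Affine algebraic toric sets of graphs\<close>

text \<open>The graph has vertex set \<open>V\<close>; its edges are numbered by the index set \<open>E\<close>, the edge with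
  number \<open>e\<close> being the two-element set \<open>ends e \<subseteq> V\<close>. A point has one coordinate for each
  element of \<open>E\<close> (and the value \<^const>\<open>undefined\<close> elsewhere).\<close>

definition toric_set :: "'v set \<Rightarrow> 'e set \<Rightarrow> ('e \<Rightarrow> 'v set) \<Rightarrow> ('e \<Rightarrow> 'a::field) set" where
  "toric_set V E ends =
     {(\<lambda>e\<in>E. \<Prod>v\<in>ends e. x v) | x. x \<in> V \<rightarrow> UNIV - {0}}"

text \<open>The disjoint union of the graphs \<open>\<G>\<^sub>i\<close>, where \<open>\<G>\<^sub>i\<close> is a union of \<open>m i\<close> disjoint
  \<open>k i\<close>-cycles. Both the vertex \<open>x\<^sup>i\<^sub>l\<close> and the \<open>l\<close>-th edge of \<open>\<G>\<^sub>i\<close> are indexed by \<open>(i, l)\<close>.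
  The pairs \<open>(i, l)\<close> with \<open>(j - 1) * k i + 1 \<le> l \<le> j * k i\<close> form the \<open>j\<close>-th cycle of \<open>\<G>\<^sub>i\<close>.\<close>

definition cyc_index :: "nat \<Rightarrow> (nat \<Rightarrow> nat) \<Rightarrow> (nat \<Rightarrow> nat) \<Rightarrow> (nat \<times> nat) set" where
  "cyc_index r k m = (SIGMA i:{1..r}. {1..k i * m i})"

definition cyc_edge :: "(nat \<Rightarrow> nat) \<Rightarrow> nat \<times> nat \<Rightarrow> (nat \<times> nat) set" where
  "cyc_edge k = (\<lambda>(i, l). {(i, l), (i, if k i dvd l then l - k i + 1 else l + 1)})"

lemma cyc_edge_inner:
  assumes "1 \<le> j" "(j - 1) * k i + 1 \<le> l" "l < j * k i"
  shows "cyc_edge k (i, l) = {(i, l), (i, l + 1)}"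
proof -
  have "\<not> k i dvd l"
  proof
    assume "k i dvd l"
    then obtain c where c: "l = c * k i" by (metis dvd_def mult.commute)
    with assms have "(j - 1) * k i < c * k i" "c * k i < j * k i" by linarith+
    then have "j - 1 < c" "c < j" by (metis mult_less_cancel2)+
    then show False by simp
  qed
  then show ?thesis by (simp add: cyc_edge_def)
qed

lemma cyc_edge_last:
  assumes "1 \<le> j"
  shows "cyc_edge k (i, j * k i) = {(i, j * k i), (i, (j - 1) * k i + 1)}"
  using assms by (simp add: cyc_edge_def diff_mult_distrib)

definition cyc_toric_set ::
  "nat \<Rightarrow> (nat \<Rightarrow> nat) \<Rightarrow> (nat \<Rightarrow> nat) \<Rightarrow> (nat \<times> nat \<Rightarrow> 'a::field) set" where
  "cyc_toric_set r k m = toric_set (cyc_index r k m) (cyc_index r k m) (cyc_edge k)"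

definition cyc_binomials ::
  "nat \<Rightarrow> (nat \<Rightarrow> nat) \<Rightarrow> (nat \<Rightarrow> nat) \<Rightarrow> nat \<Rightarrow> nat \<Rightarrow> (nat \<times> nat, 'a::comm_ring_1) mpol set" where
  "cyc_binomials q k \<gamma> i j =
     {(\<Prod>\<alpha>\<in>B. Var (i, \<alpha>) ^ ((q - 1) div 2)) -
      (\<Prod>w\<in>{(j - 1) * k i + 1..j * k i} - B. Var (i, w) ^ ((q - 1) div 2)) | B.
      B \<subseteq> {(j - 1) * k i + 1..j * k i} \<and> card B = \<gamma> i}"

end

theory Submission
  imports Defs "HOL-Computational_Algebra.Polynomial"
begin

text \<open>Let \<open>M\<close> be the leading monomial of a nonzero \<open>f\<close> in the vanishing ideal. Pulled back to the torus
  of vertex variables, the monomials of \<open>f\<close> become characters, and distinct characters are linearly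
  independent, so another monomial \<open>M'\<close> of \<open>f\<close> gives the same character as \<open>M\<close>. Going once around
  an odd cycle shows that the exponents of \<open>M\<close> and \<open>M'\<close> there differ modulo \<open>q - 1\<close> either all
  by 0 or all by \<open>h = (q - 1) / 2\<close>. If no leading monomial of \<open>G\<close> divides \<open>M\<close>, then on each cycle
  the exponents of \<open>M\<close> are below \<open>q - 1\<close> and at most \<open>\<gamma>\<close> of the \<open>2 * \<gamma> + 1\<close> exponents are at
  least \<open>h\<close>. Both kinds of difference then make the degree of \<open>M'\<close> at least that of \<open>M\<close>, with
  equality only for \<open>M' = M\<close>, which contradicts \<open>M\<close> being leading.\<close>

section \<open>Power sums over a finite field\<close>

text \<open>Multiplication by \<open>a\<close> permutes the nonzero elements, so their product is
  multiplied by \<open>a ^ card ?U\<close> and yet unchanged; cancel it.\<close>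

lemma finite_field_power_card_minus_1:
  fixes a :: "'a::{field,finite}"
  assumes "a \<noteq> 0"
  shows "a ^ (card (UNIV :: 'a set) - 1) = 1"
proof -
  let ?U = "UNIV - {0 :: 'a}"
  have bij: "bij_betw ((*) a) ?U ?U"
    by (rule bij_betwI[where g = "\<lambda>x. x / a"]) (use assms in auto)
  have "(\<Prod>x\<in>?U. x) = (\<Prod>x\<in>?U. a * x)"
    using prod.reindex_bij_betw[OF bij, of "\<lambda>x. x"] by simp
  also have "\<dots> = a ^ card ?U * (\<Prod>x\<in>?U. x)"
    by (simp add: prod.distrib)
  finally have "a ^ card ?U = 1"
    by simp
  then show ?thesis
    by (simp add: card_Diff_singleton)
qed

text \<open>Translation by 1 permutes the field, so adding 1 to each summand leaves the sum of all
  elements unchanged.\<close>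

lemma of_nat_card_UNIV_eq_0: "of_nat (card (UNIV :: 'a set)) = (0 :: 'a::{field,finite})"
proof -
  have bij: "bij_betw (\<lambda>x :: 'a. x + 1) UNIV UNIV"
    by (rule bij_betwI[where g = "\<lambda>x. x - 1"]) auto
  have "(\<Sum>x\<in>UNIV. x) = (\<Sum>x\<in>UNIV. x + (1 :: 'a))"
    using sum.reindex_bij_betw[OF bij, of "\<lambda>x. x"] by simp
  then show ?thesis
    by (simp add: sum.distrib)
qed

lemma card_field_ge_2: "card (UNIV :: 'a::{field,finite} set) \<ge> 2"
proof -
  have "card {0, 1 :: 'a} \<le> card (UNIV :: 'a set)"
    by (intro card_mono) auto
  then show ?thesis by simp
qed

text \<open>A nonzero remainder \<open>s\<close> of \<open>n\<close> modulo \<open>?N\<close> would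
  make all \<open>?N\<close> nonzero elements roots of \<open>X ^ s - 1\<close>, whose degree is
  smaller than \<open>?N\<close>.\<close>

lemma finite_field_exponent_dvd:
  assumes "\<And>a :: 'a::{field,finite}. a \<noteq> 0 \<Longrightarrow> a ^ n = 1"
  shows "card (UNIV :: 'a set) - 1 dvd n"
proof (rule ccontr)
  let ?N = "card (UNIV :: 'a set) - 1"
  assume "\<not> ?N dvd n"
  define s where "s = n mod ?N"
  have "s > 0" and "s < ?N"
    using \<open>\<not> ?N dvd n\<close> card_field_ge_2[where 'a = 'a] by (auto simp: s_def mod_greater_zero_iff_not_dvd)
  have pow: "a ^ s = 1" if "a \<noteq> 0" for a :: 'a
  proof -
    have "a ^ n = (a ^ ?N) ^ (n div ?N) * a ^ s"
      by (simp add: s_def flip: power_mult power_add)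
    then show ?thesis
      using that by (simp add: assms finite_field_power_card_minus_1 del: One_nat_def)
  qed
  define p where "p = monom (1 :: 'a) s - 1"
  have "coeff p s = 1"
    using \<open>s > 0\<close> by (simp add: p_def)
  then have "p \<noteq> 0" by auto
  have "?N = card (UNIV - {0 :: 'a})"
    by (simp add: card_Diff_singleton)
  also have "\<dots> \<le> card {x. poly p x = 0}"
    by (intro card_mono) (auto simp: p_def poly_monom pow)
  also have "\<dots> \<le> degree p"
    by (rule card_poly_roots_bound) fact
  also have "\<dots> \<le> s"
    unfolding p_def by (intro degree_diff_le) (auto simp: degree_monom_le)
  finally show False
    using \<open>s < ?N\<close> by simp
qed

text \<open>Orthogonality for the characters \<open>a \<mapsto> a ^ n\<close> of the multiplicative
  group. For a trivial character the sum is \<open>?N\<close>, which is -1 in the field; otherwise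
  some \<open>b\<close> with \<open>b ^ n \<noteq> 1\<close> rescales the sum to itself.\<close>

lemma sum_power_nonzero_eq_0_iff:
  "(\<Sum>a\<in>UNIV - {0 :: 'a::{field,finite}}. a ^ n) = 0 \<longleftrightarrow> \<not> card (UNIV :: 'a set) - 1 dvd n"
    (is "?S = 0 \<longleftrightarrow> \<not> ?N dvd n")
proof
  assume "?S = 0"
  show "\<not> ?N dvd n"
  proof
    assume "?N dvd n"
    then have "?S = (\<Sum>a\<in>UNIV - {0 :: 'a}. 1)"
      by (intro sum.cong refl) (auto elim!: dvdE simp: power_mult finite_field_power_card_minus_1 simp del: One_nat_def)
    also have "\<dots> = of_nat ?N"
      by (simp add: card_Diff_singleton)
    also have "\<dots> = - 1"
      using card_field_ge_2[where 'a = 'a] by (simp add: of_nat_diff of_nat_card_UNIV_eq_0)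
    finally show False using \<open>?S = 0\<close> by simp
  qed
next
  assume "\<not> ?N dvd n"
  then obtain b :: 'a where b: "b \<noteq> 0" "b ^ n \<noteq> 1"
    using finite_field_exponent_dvd by blast
  have bij: "bij_betw ((*) b) (UNIV - {0}) (UNIV - {0})"
    by (rule bij_betwI[where g = "\<lambda>x. x / b"]) (use b in auto)
  have "?S = b ^ n * ?S"
    using sum.reindex_bij_betw[OF bij, of "\<lambda>x. x ^ n"]
    by (simp add: power_mult_distrib sum_distrib_left)
  then show "?S = 0"
    using b by simp
qed


section \<open>Multivariate polynomials\<close>

lemma sum_single_lookup:
  "(\<Sum>m\<in>Poly_Mapping.keys f. Poly_Mapping.single m (Poly_Mapping.lookup f m)) = f"
  by (rule poly_mapping_eqI)
    (auto simp: lookup_sum lookup_single when_def in_keys_iff)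

lemma mon_eval_add:
  fixes x :: "'v \<Rightarrow> 'a::comm_monoid_mult"
  shows "(\<Prod>v\<in>Poly_Mapping.keys (m + m'). x v ^ Poly_Mapping.lookup (m + m') v) =
     (\<Prod>v\<in>Poly_Mapping.keys m. x v ^ Poly_Mapping.lookup m v) *
     (\<Prod>v\<in>Poly_Mapping.keys m'. x v ^ Poly_Mapping.lookup m' v)"
proof -
  let ?K = "Poly_Mapping.keys m \<union> Poly_Mapping.keys m'"
  have ext: "(\<Prod>v\<in>Poly_Mapping.keys n. x v ^ Poly_Mapping.lookup n v) =
      (\<Prod>v\<in>?K. x v ^ Poly_Mapping.lookup n v)" if "Poly_Mapping.keys n \<subseteq> ?K" for n
    using that by (intro prod.mono_neutral_left) (auto simp: in_keys_iff)
  show ?thesis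
    by (subst (1 2 3) ext) (auto simp: keys_add lookup_add power_add prod.distrib)
qed

section \<open>Evaluation as a ring homomorphism\<close>

lemma mpol_eval_superset:
  assumes "finite S" "Poly_Mapping.keys f \<subseteq> S"
  shows "mpol_eval x f = (\<Sum>m\<in>S. Poly_Mapping.lookup f m *
    (\<Prod>v\<in>Poly_Mapping.keys m. x v ^ Poly_Mapping.lookup m v))"
  unfolding mpol_eval_def using assms
  by (intro sum.mono_neutral_left) (auto simp: in_keys_iff)

lemma mpol_eval_0 [simp]: "mpol_eval x 0 = 0"
  by (simp add: mpol_eval_def)

lemma mpol_eval_single:
  "mpol_eval x (Poly_Mapping.single m a) =
     a * (\<Prod>v\<in>Poly_Mapping.keys m. x v ^ Poly_Mapping.lookup m v)"
  by (subst mpol_eval_superset[of "{m}"]) auto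

lemma mpol_eval_1 [simp]: "mpol_eval x 1 = 1"
  by (simp add: mpol_eval_single flip: single_one)

lemma mpol_eval_add: "mpol_eval x (f + g) = mpol_eval x f + mpol_eval x g"
proof -
  let ?K = "Poly_Mapping.keys f \<union> Poly_Mapping.keys g"
  show ?thesis
    by (subst (1 2 3) mpol_eval_superset[of ?K])
      (use keys_add[of f g] in \<open>auto simp: lookup_add distrib_right sum.distrib\<close>)
qed

lemma mpol_eval_uminus: "mpol_eval x (- f) = - mpol_eval x f"
  using mpol_eval_add[of x f "- f"] by (simp add: eq_neg_iff_add_eq_0 add.commute)

lemma mpol_eval_diff: "mpol_eval x (f - g) = mpol_eval x f - mpol_eval x g"
  using mpol_eval_add[of x f "- g"] by (simp add: mpol_eval_uminus)

lemma mpol_eval_sum: "mpol_eval x (sum f A) = (\<Sum>i\<in>A. mpol_eval x (f i))"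
  by (induction A rule: infinite_finite_induct) (auto simp: mpol_eval_add)

lemma mpol_eval_mult: "mpol_eval x (f * g) = mpol_eval x f * mpol_eval x g"
proof -
  \<comment> \<open>Expanding both factors into monomials reduces the claim to
    \<open>mon_eval_add\<close>, where exponents add.\<close>
  have "mpol_eval x (f * g) = mpol_eval x
    ((\<Sum>m\<in>Poly_Mapping.keys f. Poly_Mapping.single m (Poly_Mapping.lookup f m)) *
     (\<Sum>m\<in>Poly_Mapping.keys g. Poly_Mapping.single m (Poly_Mapping.lookup g m)))"
    by (simp only: sum_single_lookup)
  also have "\<dots> = mpol_eval x f * mpol_eval x g"
    unfolding mpol_eval_def[of x f] mpol_eval_def[of x g]
    by (simp add: sum_product mpol_eval_sum mult_single mpol_eval_single mon_eval_add mult_ac)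
  finally show ?thesis .
qed

lemma mpol_eval_power: "mpol_eval x (f ^ n) = mpol_eval x f ^ n"
  by (induction n) (auto simp: mpol_eval_mult)

lemma mpol_eval_prod: "mpol_eval x (prod f A) = (\<Prod>i\<in>A. mpol_eval x (f i))"
  by (induction A rule: infinite_finite_induct) (auto simp: mpol_eval_mult)

lemma mpol_eval_Var: "mpol_eval x (Var v) = x v"
  by (simp add: Var_def mpol_eval_single)

lemma Var_power: "Var v ^ n = Poly_Mapping.single (Poly_Mapping.single v n) 1"
  by (induction n) (auto simp: Var_def mult_single simp flip: single_add)

lemma prod_Var_power:
  "finite B \<Longrightarrow> (\<Prod>v\<in>B. Var v ^ n) =
     Poly_Mapping.single (\<Sum>v\<in>B. Poly_Mapping.single v n) 1"
  by (induction B rule: finite_induct) (auto simp: Var_power mult_single)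

section \<open>The polynomial ring and the vanishing ideal\<close>

lemma ring_mpoly_ring: "ring (mpoly_ring V)"
proof (rule ringI)
  show "abelian_group (mpoly_ring V)"
  proof (rule abelian_groupI, goal_cases)
    case (1 f g)
    then show ?case
      using keys_add[of f g] by (auto simp: mpoly_ring_def)
  next
    case (6 f)
    then show ?case
      by (intro bexI[of _ "- f"]) (auto simp: mpoly_ring_def)
  qed (auto simp: mpoly_ring_def add_ac)
  show "monoid (mpoly_ring V)"
  proof (rule monoidI, goal_cases)
    case (1 f g)
    show ?case
      unfolding mpoly_ring_def
    proof (clarsimp)
      fix m v
      assume "m \<in> Poly_Mapping.keys (f * g)" and v: "v \<in> Poly_Mapping.keys m"
      then obtain a b where "a \<in> Poly_Mapping.keys f" "b \<in> Poly_Mapping.keys g" "m = a + b"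
        using keys_mult[of f g] by blast
      with v 1 show "v \<in> V"
        using keys_add[of a b] by (fastforce simp: mpoly_ring_def)
    qed
  qed (auto simp: mpoly_ring_def mult_ac)
qed (auto simp: mpoly_ring_def algebra_simps)

lemma ideal_vanishing_ideal:
  fixes X :: "('v \<Rightarrow> 'a::comm_ring_1) set"
  shows "ideal (vanishing_ideal V X) (mpoly_ring V)"
proof -
  let ?R = "mpoly_ring V :: ('v, 'a) mpol ring"
  interpret ring ?R by (rule ring_mpoly_ring)
  \<comment> \<open>The additive inverse of the ring record is an abstract choice; it must be
    identified with \<open>- f\<close> before evaluation can be applied to it.\<close>
  have a_inv: "\<ominus>\<^bsub>?R\<^esub> f = - f" if "f \<in> carrier ?R" for f
    using that by (intro minus_equality) (auto simp: mpoly_ring_def)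
  show ?thesis
  proof (rule idealI)
    show "subgroup (vanishing_ideal V X) (add_monoid ?R)"
    proof (rule add.subgroupI)
      have "0 \<in> vanishing_ideal V X"
        by (simp add: vanishing_ideal_def mpoly_ring_def)
      then show "vanishing_ideal V X \<noteq> {}" by blast
    next
      fix f assume "f \<in> vanishing_ideal V X"
      moreover from this have "\<ominus>\<^bsub>?R\<^esub> f = - f"
        by (intro a_inv) (simp add: vanishing_ideal_def)
      moreover from calculation have "- f \<in> carrier ?R"
        by (metis (no_types, lifting) a_inv_closed mem_Collect_eq vanishing_ideal_def)
      ultimately show "\<ominus>\<^bsub>?R\<^esub> f \<in> vanishing_ideal V X"
        by (simp add: vanishing_ideal_def mpol_eval_uminus)
    next
      fix f g assume fg: "f \<in> vanishing_ideal V X" "g \<in> vanishing_ideal V X"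
      then have "f \<oplus>\<^bsub>?R\<^esub> g \<in> carrier ?R"
        by (intro a_closed) (auto simp: vanishing_ideal_def)
      with fg show "f \<oplus>\<^bsub>?R\<^esub> g \<in> vanishing_ideal V X"
        by (simp add: vanishing_ideal_def mpoly_ring_def mpol_eval_add)
    qed (auto simp: vanishing_ideal_def)
  next
    fix f g
    assume fg: "f \<in> vanishing_ideal V X" "g \<in> carrier ?R"
    then have "g \<otimes>\<^bsub>?R\<^esub> f \<in> carrier ?R"
      by (intro m_closed) (auto simp: vanishing_ideal_def)
    with fg show "g \<otimes>\<^bsub>?R\<^esub> f \<in> vanishing_ideal V X"
      "f \<otimes>\<^bsub>?R\<^esub> g \<in> vanishing_ideal V X"
      by (simp_all add: vanishing_ideal_def mpoly_ring_def mpol_eval_mult mult.commute)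
  qed (rule ring_mpoly_ring)
qed


section \<open>Leading monomials and Groebner bases\<close>

lemma total_deg_superset:
  assumes "finite S" "Poly_Mapping.keys m \<subseteq> S"
  shows "total_deg m = (\<Sum>v\<in>S. Poly_Mapping.lookup m v)"
  unfolding total_deg_def using assms
  by (intro sum.mono_neutral_left) (auto simp: in_keys_iff)

lemma grlex_less_irrefl: "\<not> grlex_less V ord m m"
  by (auto simp: grlex_less_def)

lemma grlex_less_total:
  assumes "finite V" "linear_order_on V ord"
    and "Poly_Mapping.keys a \<subseteq> V" "Poly_Mapping.keys b \<subseteq> V" "a \<noteq> b"
  shows "grlex_less V ord a b \<or> grlex_less V ord b a"
proof (cases "total_deg a = total_deg b")
  case deg: True
  \<comment> \<open>The largest variable in \<open>D\<close> decides the comparison: above it the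
    exponents agree.\<close>
  define D where "D = {v \<in> V. Poly_Mapping.lookup a v \<noteq> Poly_Mapping.lookup b v}"
  have "Poly_Mapping.lookup a v = Poly_Mapping.lookup b v" if "v \<notin> V" for v
    using that assms(3,4) by (metis in_keys_iff subsetD)
  then have "D \<noteq> {}"
    using \<open>a \<noteq> b\<close> by (auto simp: D_def intro!: poly_mapping_eqI)
  have "totalp_on D (\<lambda>x y. (x, y) \<in> ord)"
    using assms(2) by (auto simp: totalp_on_def linear_order_on_def total_on_def D_def)
  moreover have "transp_on D (\<lambda>x y. (x, y) \<in> ord)"
    using assms(2) by (auto simp: transp_on_def order_on_defs intro: transD)
  ultimately obtain v where v: "v \<in> D" "\<And>u. u \<in> D \<Longrightarrow> u \<noteq> v \<Longrightarrow> (u, v) \<in> ord"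
    using Finite_Set.bex_greatest_element[of D "\<lambda>x y. (x, y) \<in> ord"] \<open>D \<noteq> {}\<close> assms(1)
    by (auto simp: D_def)
  have eq: "Poly_Mapping.lookup a u = Poly_Mapping.lookup b u" if "u \<in> V" "(v, u) \<in> ord" "u \<noteq> v" for u
  proof (rule ccontr)
    assume "Poly_Mapping.lookup a u \<noteq> Poly_Mapping.lookup b u"
    with that v(2)[of u] have "(u, v) \<in> ord" by (simp add: D_def)
    with that assms(2) show False
      by (auto simp: order_on_defs dest: antisymD)
  qed
  have "v \<in> V" "Poly_Mapping.lookup a v \<noteq> Poly_Mapping.lookup b v"
    using v(1) by (auto simp: D_def)
  then show ?thesis
    unfolding grlex_less_def using deg eq by (metis linorder_neqE_nat)
qed (auto simp: grlex_less_def)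

lemma grlex_less_trans:
  assumes "linear_order_on V ord" "grlex_less V ord a b" "grlex_less V ord b c"
  shows "grlex_less V ord a c"
proof (cases "total_deg a = total_deg b \<and> total_deg b = total_deg c")
  case True
  obtain v where v: "v \<in> V" "Poly_Mapping.lookup a v < Poly_Mapping.lookup b v"
      "\<And>u. u \<in> V \<Longrightarrow> (v, u) \<in> ord \<Longrightarrow> u \<noteq> v \<Longrightarrow> Poly_Mapping.lookup a u = Poly_Mapping.lookup b u"
    using assms(2) True by (auto simp: grlex_less_def)
  obtain w where w: "w \<in> V" "Poly_Mapping.lookup b w < Poly_Mapping.lookup c w"
      "\<And>u. u \<in> V \<Longrightarrow> (w, u) \<in> ord \<Longrightarrow> u \<noteq> w \<Longrightarrow> Poly_Mapping.lookup b u = Poly_Mapping.lookup c u"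
    using assms(3) True by (auto simp: grlex_less_def)
  have tr: "(x, z) \<in> ord" if "(x, y) \<in> ord" "(y, z) \<in> ord" for x y z
    using assms(1) that by (auto simp: order_on_defs intro: transD)
  have as: "x = y" if "(x, y) \<in> ord" "(y, x) \<in> ord" for x y
    using assms(1) that by (auto simp: order_on_defs dest: antisymD)
  \<comment> \<open>The larger of the two deciding variables decides between \<open>a\<close> and
    \<open>c\<close>.\<close>
  consider "v = w" | "v \<noteq> w" "(v, w) \<in> ord" | "v \<noteq> w" "(w, v) \<in> ord"
    using assms(1) v(1) w(1) by (auto simp: linear_order_on_def total_on_def)
  then have "\<exists>x\<in>V. Poly_Mapping.lookup a x < Poly_Mapping.lookup c x \<and>
      (\<forall>u\<in>V. (x, u) \<in> ord \<and> u \<noteq> x \<longrightarrow> Poly_Mapping.lookup a u = Poly_Mapping.lookup c u)"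
  proof cases
    case 1
    with v w show ?thesis by (intro bexI[of _ v]) auto
  next
    case 2
    have "Poly_Mapping.lookup a u = Poly_Mapping.lookup c u" if "u \<in> V" "(w, u) \<in> ord" "u \<noteq> w" for u
      using that v(3)[of u] w(3)[of u] tr[of v w u] as[of v w] 2 by auto
    moreover have "Poly_Mapping.lookup a w < Poly_Mapping.lookup c w"
      using v(3)[of w] w 2 by auto
    ultimately show ?thesis using w(1) by blast
  next
    case 3
    have "Poly_Mapping.lookup a u = Poly_Mapping.lookup c u" if "u \<in> V" "(v, u) \<in> ord" "u \<noteq> v" for u
      using that v(3)[of u] w(3)[of u] tr[of w v u] as[of v w] 3 by auto
    moreover have "Poly_Mapping.lookup a v < Poly_Mapping.lookup c v"
      using w(3)[of v] v 3 by auto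
    ultimately show ?thesis using v(1) by blast
  qed
  with True show ?thesis by (simp add: grlex_less_def)
next
  case False
  with assms(2,3) show ?thesis by (auto simp: grlex_less_def)
qed

text \<open>\<open>lt\<close> is an arbitrary relation here, so the clause
  \<open>\<not> lt m m'\<close> supplies the uniqueness that the definite description
  requires.\<close>

lemma lead_mon_eqI:
  assumes "m \<in> Poly_Mapping.keys f"
    and "\<And>m'. m' \<in> Poly_Mapping.keys f \<Longrightarrow> m' \<noteq> m \<Longrightarrow> lt m' m \<and> \<not> lt m m'"
  shows "lead_mon lt f = m"
  unfolding lead_mon_def using assms by (intro the_equality) metis+

lemma
  assumes "finite V" "linear_order_on V ord" "f \<in> carrier (mpoly_ring V)" "f \<noteq> 0"
  shows lead_mon_grlex_in_keys: "lead_mon (grlex_less V ord) f \<in> Poly_Mapping.keys f"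
    and lead_mon_grlex_greatest: "\<And>m. m \<in> Poly_Mapping.keys f \<Longrightarrow>
      m \<noteq> lead_mon (grlex_less V ord) f \<Longrightarrow> grlex_less V ord m (lead_mon (grlex_less V ord) f)"
proof -
  let ?K = "Poly_Mapping.keys f"
  have "totalp_on ?K (grlex_less V ord)"
    using grlex_less_total[OF assms(1,2)] assms(3) by (auto simp: totalp_on_def mpoly_ring_def)
  moreover have "transp_on ?K (grlex_less V ord)"
    using grlex_less_trans[OF assms(2)] by (auto simp: transp_on_def)
  ultimately obtain m where m: "m \<in> ?K" "\<forall>m'\<in>?K. m' \<noteq> m \<longrightarrow> grlex_less V ord m' m"
    using Finite_Set.bex_greatest_element[of ?K "grlex_less V ord"] assms(4) by auto
  then have "lead_mon (grlex_less V ord) f = m"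
    using grlex_less_trans[OF assms(2)] grlex_less_irrefl by (intro lead_mon_eqI) blast+
  with m show "lead_mon (grlex_less V ord) f \<in> ?K"
    and "\<And>m. m \<in> ?K \<Longrightarrow> m \<noteq> lead_mon (grlex_less V ord) f
      \<Longrightarrow> grlex_less V ord m (lead_mon (grlex_less V ord) f)" by auto
qed

text \<open>Total degree alone decides. Every element of the basis is such a binomial, so its
  leading monomial does not depend on the order of the variables.\<close>

lemma lead_mon_grlex_binomial:
  fixes a b :: "'v \<Rightarrow>\<^sub>0 nat" and c d :: "'a::comm_ring_1"
  assumes "c \<noteq> 0" "d \<noteq> 0" "total_deg b < total_deg a"
  defines "f \<equiv> Poly_Mapping.single a c + Poly_Mapping.single b d"
  shows "f \<noteq> 0" "lead_mon (grlex_less V ord) f = a"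
proof -
  have ne: "a \<noteq> b" using assms(3) by auto
  then have "a \<in> Poly_Mapping.keys f"
    using assms(1) by (auto simp: f_def in_keys_iff lookup_add lookup_single)
  moreover have "Poly_Mapping.keys f \<subseteq> {a, b}"
    using keys_add[of "Poly_Mapping.single a c" "Poly_Mapping.single b d"] by (auto simp: f_def split: if_splits)
  ultimately show "f \<noteq> 0" "lead_mon (grlex_less V ord) f = a"
    using assms(3) by (auto intro!: lead_mon_eqI simp: grlex_less_def)
qed

text \<open>Over a field, divisibility of leading monomials suffices: the coefficients can be
  divided too, so the leading term of \<open>f\<close> is a multiple of that of
  \<open>g\<close>.\<close>

lemma groebner_basis_grlexI:
  fixes G I :: "('v, 'a::field) mpol set"
  assumes "finite V" "linear_order_on V ord" "ideal I (mpoly_ring V)" "finite G" "G \<subseteq> I"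
    and div: "\<And>f. f \<in> I \<Longrightarrow> f \<noteq> 0 \<Longrightarrow> \<exists>g\<in>G - {0}. \<forall>v.
      Poly_Mapping.lookup (lead_mon (grlex_less V ord) g) v
        \<le> Poly_Mapping.lookup (lead_mon (grlex_less V ord) f) v"
  shows "groebner_basis V (grlex_less V ord) G I"
proof -
  let ?R = "mpoly_ring V :: ('v, 'a) mpol ring" and ?lt = "grlex_less V ord"
  interpret ring ?R by (rule ring_mpoly_ring)
  have I: "I \<subseteq> carrier ?R"
    using assms(3) by (meson additive_subgroup.a_subset ideal.axioms(1))
  have keys: "Poly_Mapping.keys (lead_mon ?lt f) \<subseteq> V" if "f \<in> I" "f \<noteq> 0" for f
    using lead_mon_grlex_in_keys[OF assms(1,2), of f] that I by (auto simp: mpoly_ring_def)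
  have lt_carrier: "lead_term ?lt ` (I - {0}) \<subseteq> carrier ?R"
    using keys by (fastforce simp: lead_term_def mpoly_ring_def split: if_splits)
  have G_le: "lead_term ?lt ` (G - {0}) \<subseteq> lead_term ?lt ` (I - {0})"
    using assms(5) by blast
  interpret LG: ideal "Idl\<^bsub>?R\<^esub> (lead_term ?lt ` (G - {0}))" ?R
    using G_le lt_carrier by (intro genideal_ideal) blast
  have "lead_term ?lt f \<in> Idl\<^bsub>?R\<^esub> (lead_term ?lt ` (G - {0}))" if f: "f \<in> I" "f \<noteq> 0" for f
  proof -
    obtain g where g: "g \<in> G - {0}" and
      le: "\<And>v. Poly_Mapping.lookup (lead_mon ?lt g) v \<le> Poly_Mapping.lookup (lead_mon ?lt f) v"
      using div[OF f] by blast
    \<comment> \<open>The pointwise subtraction on naturals is exact by \<open>le\<close>.\<close>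
    define t where "t = lead_mon ?lt f - lead_mon ?lt g"
    have t: "t + lead_mon ?lt g = lead_mon ?lt f"
      by (rule poly_mapping_eqI) (simp add: t_def lookup_add lookup_minus le)
    define h where "h = Poly_Mapping.single t
      (Poly_Mapping.lookup f (lead_mon ?lt f) / Poly_Mapping.lookup g (lead_mon ?lt g))"
    have "Poly_Mapping.keys t \<subseteq> Poly_Mapping.keys (lead_mon ?lt f)"
      by (auto simp: t_def in_keys_iff lookup_minus)
    with keys[OF f] have "h \<in> carrier ?R"
      by (auto simp: h_def mpoly_ring_def split: if_splits)
    moreover have "lead_term ?lt g \<in> Idl\<^bsub>?R\<^esub> (lead_term ?lt ` (G - {0}))"
      using genideal_self[of "lead_term ?lt ` (G - {0})"] G_le lt_carrier g by blast
    ultimately have "h \<otimes>\<^bsub>?R\<^esub> lead_term ?lt g \<in> Idl\<^bsub>?R\<^esub> (lead_term ?lt ` (G - {0}))"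
      by (intro LG.I_l_closed)
    moreover have "Poly_Mapping.lookup g (lead_mon ?lt g) \<noteq> 0"
      using lead_mon_grlex_in_keys[OF assms(1,2), of g] g assms(5) I by (auto simp: in_keys_iff)
    then have "h \<otimes>\<^bsub>?R\<^esub> lead_term ?lt g = lead_term ?lt f"
      by (simp add: h_def mpoly_ring_def lead_term_def mult_single t)
    ultimately show ?thesis by simp
  qed
  then have "Idl\<^bsub>?R\<^esub> (lead_term ?lt ` (I - {0})) \<subseteq> Idl\<^bsub>?R\<^esub> (lead_term ?lt ` (G - {0}))"
    by (intro genideal_minimal LG.ideal_axioms) auto
  moreover have "Idl\<^bsub>?R\<^esub> (lead_term ?lt ` (G - {0})) \<subseteq> Idl\<^bsub>?R\<^esub> (lead_term ?lt ` (I - {0}))"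
    by (rule subset_Idl_subset[OF lt_carrier G_le])
  ultimately show ?thesis
    using assms(3-5) by (auto simp: groebner_basis_def)
qed


section \<open>Monomials on the toric set\<close>

text \<open>Edge \<open>e\<close> joins the vertices \<open>e\<close> and \<open>s e\<close>, so
  vertex \<open>v\<close> lies on the edges \<open>v\<close> and \<open>t v\<close>, where
  \<open>t\<close> inverts \<open>s\<close>. The sum over the torus therefore factors into one power
  sum per vertex, and orthogonality applies to each.\<close>

lemma sum_toric_monomial_eq_0_iff:
  fixes c :: "'v \<Rightarrow> nat"
  assumes "finite V" and bij: "bij_betw s V V"
  shows "(\<Sum>x\<in>V \<rightarrow>\<^sub>E UNIV - {0 :: 'a::{field,finite}}. \<Prod>e\<in>V. (x e * x (s e)) ^ c e) = 0 \<longleftrightarrow>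
    (\<exists>e\<in>V. \<not> card (UNIV :: 'a set) - 1 dvd c e + c (s e))" (is "?S = 0 \<longleftrightarrow> _")
proof -
  define t where "t = inv_into V s"
  have t: "t (s e) = e" if "e \<in> V" for e
    using bij that by (simp add: t_def bij_betw_inv_into_left)
  have "(\<Prod>e\<in>V. (x e * x (s e)) ^ c e) = (\<Prod>v\<in>V. x v ^ (c v + c (t v)))" for x :: "'v \<Rightarrow> 'a"
  proof -
    have "(\<Prod>e\<in>V. x (s e) ^ c e) = (\<Prod>e\<in>V. x (s e) ^ c (t (s e)))"
      by (simp add: t)
    also have "\<dots> = (\<Prod>v\<in>V. x v ^ c (t v))"
      by (rule prod.reindex_bij_betw[OF bij])
    finally show ?thesis
      by (simp add: power_mult_distrib prod.distrib power_add)
  qed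
  then have "?S = (\<Prod>v\<in>V. \<Sum>a\<in>UNIV - {0 :: 'a}. a ^ (c v + c (t v)))"
    using \<open>finite V\<close> by (simp add: prod_sum_PiE)
  \<comment> \<open>Naming the vertices \<open>s e\<close> eliminates \<open>t\<close> from the
    exponents.\<close>
  also have "\<dots> = (\<Prod>e\<in>V. \<Sum>a\<in>UNIV - {0 :: 'a}. a ^ (c (s e) + c (t (s e))))"
    by (rule prod.reindex_bij_betw[OF bij, symmetric])
  also have "\<dots> = (\<Prod>e\<in>V. \<Sum>a\<in>UNIV - {0 :: 'a}. a ^ (c e + c (s e)))"
    by (simp add: t add.commute)
  finally show ?thesis
    using \<open>finite V\<close> by (simp add: sum_power_nonzero_eq_0_iff del: One_nat_def)
qed

text \<open>The monomials of a polynomial restrict to characters of the torus. A vanishing linear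
  combination of characters cannot contain a character that occurs only once; this is seen by
  averaging against the inverse character, whose exponents are \<open>N - 1\<close> times those of \<open>m\<close>.\<close>

lemma vanishing_ideal_toric_set_other_monomial:
  fixes f :: "('v, 'a::{field,finite}) mpol"
  assumes "finite V" and bij: "bij_betw s V V"
    and ends: "\<And>e. e \<in> V \<Longrightarrow> ends e = {e, s e} \<and> s e \<noteq> e"
    and f: "f \<in> vanishing_ideal V (toric_set V V ends)"
    and m: "m \<in> Poly_Mapping.keys f"
  obtains m' where "m' \<in> Poly_Mapping.keys f" "m' \<noteq> m"
    "\<And>e. e \<in> V \<Longrightarrow> int (card (UNIV :: 'a set) - 1) dvd
      (int (Poly_Mapping.lookup m' e) - int (Poly_Mapping.lookup m e)) +
      (int (Poly_Mapping.lookup m' (s e)) - int (Poly_Mapping.lookup m (s e)))"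
proof -
  define N where "N = card (UNIV :: 'a set) - 1"
  have "N \<ge> 1"
    using card_field_ge_2[where 'a = 'a] by (simp add: N_def)
  define c where "c m' e = Poly_Mapping.lookup m' e + (N - 1) * Poly_Mapping.lookup m e" for m' e
  \<comment> \<open>The unnormalised inner product of the characters of \<open>m'\<close> and
    \<open>m\<close>.\<close>
  define T where "T m' = (\<Sum>x\<in>V \<rightarrow>\<^sub>E UNIV - {0 :: 'a}. \<Prod>e\<in>V. (x e * x (s e)) ^ c m' e)" for m'
  have T0: "T m' = 0 \<longleftrightarrow> (\<exists>e\<in>V. \<not> N dvd c m' e + c m' (s e))" for m'
    unfolding T_def N_def by (rule sum_toric_monomial_eq_0_iff) fact+
  have "c m e = N * Poly_Mapping.lookup m e" for e
    using \<open>N \<ge> 1\<close> by (cases N) (auto simp: c_def)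
  \<comment> \<open>For \<open>m\<close> itself all exponents are multiples of \<open>N\<close>, so
    the divisibility criterion \<open>T0\<close> holds at every edge.\<close>
  then have "T m \<noteq> 0"
    by (simp add: T0)
  have "(\<Sum>m'\<in>Poly_Mapping.keys f. Poly_Mapping.lookup f m' *
      (\<Prod>e\<in>V. (x e * x (s e)) ^ c m' e)) = 0" if x: "x \<in> V \<rightarrow>\<^sub>E UNIV - {0}" for x
  proof -
    define p where "p = (\<lambda>e\<in>V. x e * x (s e))"
    \<comment> \<open>The product runs over a set, so both factors appear only because the two ends
      differ.\<close>
    have "(\<Prod>v\<in>ends e. x v) = x e * x (s e)" if "e \<in> V" for e
    proof -
      have "e \<noteq> s e" using ends[OF that] by metis
      then show ?thesis using ends[OF that] by simp
    qed
    then have "p = (\<lambda>e\<in>V. \<Prod>v\<in>ends e. x v)"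
      by (simp add: p_def cong: restrict_cong)
    then have "p \<in> toric_set V V ends"
      using x by (auto simp: toric_set_def)
    then have "mpol_eval p f = 0"
      using f by (simp add: vanishing_ideal_def)
    \<comment> \<open>The inverse character contributes the same factor to every monomial, so the
      whole sum is the value of \<open>f\<close> at \<open>p\<close> times that factor.\<close>
    have "Poly_Mapping.lookup f m' * (\<Prod>e\<in>V. (x e * x (s e)) ^ c m' e) =
        Poly_Mapping.lookup f m' *
        (\<Prod>v\<in>Poly_Mapping.keys m'. p v ^ Poly_Mapping.lookup m' v) *
        (\<Prod>e\<in>V. p e ^ ((N - 1) * Poly_Mapping.lookup m e))" if "m' \<in> Poly_Mapping.keys f" for m'
    proof -
      have "Poly_Mapping.keys m' \<subseteq> V"
        using f that by (auto simp: vanishing_ideal_def mpoly_ring_def)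
      then have "(\<Prod>v\<in>Poly_Mapping.keys m'. p v ^ Poly_Mapping.lookup m' v) =
          (\<Prod>v\<in>V. p v ^ Poly_Mapping.lookup m' v)"
        using \<open>finite V\<close> by (intro prod.mono_neutral_left) (auto simp: in_keys_iff)
      then show ?thesis
        by (simp add: c_def p_def power_add prod.distrib)
    qed
    then have "(\<Sum>m'\<in>Poly_Mapping.keys f. Poly_Mapping.lookup f m' *
        (\<Prod>e\<in>V. (x e * x (s e)) ^ c m' e)) =
        mpol_eval p f * (\<Prod>e\<in>V. p e ^ ((N - 1) * Poly_Mapping.lookup m e))"
      unfolding mpol_eval_def sum_distrib_right by (rule sum.cong[OF refl])
    with \<open>mpol_eval p f = 0\<close> show ?thesis by simp
  qed
  then have "(\<Sum>x\<in>V \<rightarrow>\<^sub>E UNIV - {0}. \<Sum>m'\<in>Poly_Mapping.keys f. Poly_Mapping.lookup f m' *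
      (\<Prod>e\<in>V. (x e * x (s e)) ^ c m' e)) = 0"
    by simp
  then have "(\<Sum>m'\<in>Poly_Mapping.keys f. Poly_Mapping.lookup f m' * T m') = 0"
    unfolding T_def sum_distrib_left by (subst sum.swap)
  moreover have "Poly_Mapping.lookup f m * T m \<noteq> 0"
    using \<open>T m \<noteq> 0\<close> m by (simp add: in_keys_iff)
  \<comment> \<open>The nonzero term of \<open>m\<close> has to be cancelled, so some other
    \<open>T m'\<close> is nonzero, which means that \<open>m'\<close> has the same
    character.\<close>
  ultimately have "(\<Sum>m'\<in>Poly_Mapping.keys f - {m}. Poly_Mapping.lookup f m' * T m') \<noteq> 0"
    using m by (auto simp: sum.remove)
  then obtain m' where m': "m' \<in> Poly_Mapping.keys f - {m}" "Poly_Mapping.lookup f m' * T m' \<noteq> 0"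
    by (rule sum.not_neutral_contains_not_neutral)
  have "int N dvd (int (Poly_Mapping.lookup m' e) - int (Poly_Mapping.lookup m e)) +
      (int (Poly_Mapping.lookup m' (s e)) - int (Poly_Mapping.lookup m (s e)))"
    (is "_ dvd ?d") if "e \<in> V" for e
  proof -
    have "N dvd c m' e + c m' (s e)"
      using m'(2) T0[of m'] that by auto
    then have "int N dvd int (c m' e + c m' (s e))" by (simp only: int_dvd_int_iff)
    \<comment> \<open>Replacing the factor \<open>N - 1\<close> by -1 changes the exponents only by
      multiples of \<open>N\<close>.\<close>
    also have "int (c m' e + c m' (s e)) =
        ?d + int N * (int (Poly_Mapping.lookup m e) + int (Poly_Mapping.lookup m (s e)))"
      using \<open>N \<ge> 1\<close> by (cases N) (simp_all add: c_def algebra_simps)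
    finally show ?thesis
      by (simp add: dvd_add_left_iff)
  qed
  then show ?thesis
    using m' by (intro that[of m']) (auto simp: N_def)
qed


section \<open>Odd cycles\<close>

text \<open>Each step along the path flips the sign modulo \<open>n\<close>. Since
  \<open>k - 1\<close> is even, the last value is congruent to \<open>d 0\<close>, and the closing
  edge yields \<open>2 * d 0\<close>. Modulo \<open>n\<close> the sign of \<open>d 0\<close> then no
  longer matters.\<close>

lemma odd_cycle_alternating:
  fixes d :: "nat \<Rightarrow> int"
  assumes "odd k" and step: "\<And>s. s + 1 < k \<Longrightarrow> n dvd d s + d (s + 1)"
    and last: "n dvd d (k - 1) + d 0" and "s < k"
  shows "n dvd 2 * d 0" "n dvd d s - d 0"
proof -
  have alt: "n dvd d s - (- 1) ^ s * d 0" if "s < k" for s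
    using that
  proof (induction s)
    case (Suc s)
    then have "n dvd (d s + d (s + 1)) - (d s - (- 1) ^ s * d 0)"
      using dvd_diff[OF step[of s], of "d s - (- 1) ^ s * d 0"] by simp
    then show ?case by simp
  qed simp
  have "n dvd d (k - 1) - d 0"
    using alt[of "k - 1"] \<open>odd k\<close> by (simp add: odd_pos)
  from dvd_diff[OF last this] show two: "n dvd 2 * d 0" by simp
  show "n dvd d s - d 0"
  proof (cases "even s")
    case False
    then have "n dvd d s + d 0" using alt[OF \<open>s < k\<close>] by simp
    from dvd_diff[OF this two] show ?thesis by simp
  qed (use alt[OF \<open>s < k\<close>] in simp)
qed

text \<open>All values are congruent to \<open>d 0\<close>, which is a multiple of \<open>h\<close>;
  the parity of the quotient selects the alternative.\<close>

lemma odd_cycle_exponent_dichotomy: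
  fixes d :: "nat \<Rightarrow> int"
  assumes "odd k" "\<And>s. s + 1 < k \<Longrightarrow> int (2 * h) dvd d s + d (s + 1)"
    and "int (2 * h) dvd d (k - 1) + d 0"
  shows "(\<forall>s<k. int (2 * h) dvd d s) \<or> (\<forall>s<k. int (2 * h) dvd d s - int h)"
proof -
  have "int (2 * h) dvd 2 * d 0"
    by (rule odd_cycle_alternating(1)[of k _ d 0]) (use assms in \<open>auto simp: odd_pos\<close>)
  then obtain z where z: "d 0 = int h * z"
    by (auto elim: dvdE)
  have alt: "int (2 * h) dvd d s - d 0" if "s < k" for s
    by (rule odd_cycle_alternating(2)[of k]) (use assms that in auto)
  show ?thesis
  proof (cases "even z")
    case True
    then have "int (2 * h) dvd d 0"
      by (auto simp: z elim!: evenE)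
    then have "int (2 * h) dvd d s" if "s < k" for s
      using dvd_add[OF alt[OF that]] by fastforce
    then show ?thesis by blast
  next
    case False
    then have "int (2 * h) dvd d 0 - int h"
      by (auto simp: z algebra_simps elim!: oddE)
    then have "int (2 * h) dvd d s - int h" if "s < k" for s
      using dvd_add[OF alt[OF that]] by fastforce
    then show ?thesis by blast
  qed
qed

text \<open>On an odd cycle, shifting all exponents by \<open>h\<close> modulo \<open>2 * h\<close> strictly increases the degree
  of a reduced monomial, because fewer than half of its exponents are at least \<open>h\<close>.\<close>

lemma reduced_exponents_minimal:
  fixes a b :: "'v \<Rightarrow> nat"
  assumes "finite C" "card C = 2 * \<gamma> + 1" "h > 0"
    and lt: "\<And>v. v \<in> C \<Longrightarrow> a v < 2 * h" and big: "card {v \<in> C. h \<le> a v} \<le> \<gamma>"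
    and cong: "(\<forall>v\<in>C. int (2 * h) dvd int (b v) - int (a v)) \<or>
      (\<forall>v\<in>C. int (2 * h) dvd int (b v) - int (a v) - int h)"
  shows "sum a C < sum b C \<or> (\<forall>v\<in>C. a v \<le> b v)"
  using cong
proof
  assume *: "\<forall>v\<in>C. int (2 * h) dvd int (b v) - int (a v)"
  \<comment> \<open>A positive \<open>a v - b v\<close> would be a multiple of \<open>2 * h\<close>,
    but \<open>a v\<close> is below \<open>2 * h\<close>.\<close>
  have "a v \<le> b v" if v: "v \<in> C" for v
  proof (rule ccontr)
    assume "\<not> a v \<le> b v"
    then have "0 < int (a v) - int (b v)" by simp
    moreover have "int (2 * h) dvd int (a v) - int (b v)"
      using * v dvd_minus_iff[of "int (2 * h)" "int (b v) - int (a v)"] by auto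
    ultimately have "int (2 * h) \<le> int (a v) - int (b v)"
      by (intro zdvd_imp_le)
    with lt[OF v] show False by linarith
  qed
  then show ?thesis by blast
next
  assume *: "\<forall>v\<in>C. int (2 * h) dvd int (b v) - int (a v) - int h"
  define L where "L = {v \<in> C. h \<le> a v}"
  \<comment> \<open>\<open>b v = a v + h + 2 * h * z\<close> is nonnegative, so
    \<open>z \<ge> - 1\<close>, and \<open>z \<ge> 0\<close> if \<open>a v < h\<close>. Thus
    \<open>b v\<close> is at least \<open>a v + h\<close> off \<open>L\<close> and at least
    \<open>a v - h\<close> on \<open>L\<close>; the bound is arranged with sums on both sides to
    avoid natural subtraction.\<close>
  have ge: "a v + (if v \<in> L then 0 else h) \<le> b v + (if v \<in> L then h else 0)" if v: "v \<in> C" for v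
  proof -
    obtain z where z: "int (b v) - int (a v) - int h = int (2 * h) * z"
      using * v by (auto elim: dvdE)
    have "z \<ge> - 1"
    proof (rule ccontr)
      assume "\<not> z \<ge> - 1"
      then have "int (2 * h) * z \<le> int (2 * h) * (- 2)"
        by (intro mult_left_mono) auto
      with z lt[OF v] show False by simp
    qed
    moreover have "z \<ge> 0" if "a v < h"
    proof (rule ccontr)
      assume "\<not> z \<ge> 0"
      then have "int (2 * h) * z \<le> int (2 * h) * (- 1)"
        by (intro mult_left_mono) auto
      with z that show False by simp
    qed
    ultimately have "int (2 * h) * z \<ge> int (2 * h) * (if a v < h then 0 else - 1)"
      by (intro mult_left_mono) auto
    with z v show ?thesis by (auto simp: L_def split: if_splits)
  qed
  have fin: "finite L" and "L \<subseteq> C" using \<open>finite C\<close> by (auto simp: L_def)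
  have "C \<inter> - L = C - L" and "C \<inter> L = L" using \<open>L \<subseteq> C\<close> by auto
  moreover have "(\<Sum>v\<in>C. a v + (if v \<in> L then 0 else h)) \<le> (\<Sum>v\<in>C. b v + (if v \<in> L then h else 0))"
    by (rule sum_mono) (rule ge)
  ultimately have "sum a C + card (C - L) * h \<le> sum b C + card L * h"
    using \<open>finite C\<close> by (simp add: sum.distrib sum.If_cases)
  \<comment> \<open>At most \<gamma> elements lie in \<open>L\<close> and at least \<gamma> + 1
    outside, so the gains of \<open>h\<close> outnumber the losses.\<close>
  moreover have "card L < card (C - L)"
    using assms(2) big fin \<open>L \<subseteq> C\<close> by (simp add: card_Diff_subset flip: L_def)
  then have "card L * h < card (C - L) * h"
    using \<open>h > 0\<close> by simp
  ultimately have "sum a C < sum b C" by linarith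
  then show ?thesis ..
qed

section \<open>Unions of disjoint cycles\<close>

text \<open>The pair \<open>(i, j)\<close> names a cycle. Its block serves both as vertex set and as
  set of edge numbers.\<close>

definition cyc_block :: "(nat \<Rightarrow> nat) \<Rightarrow> nat \<times> nat \<Rightarrow> (nat \<times> nat) set" where
  "cyc_block k = (\<lambda>(i, j). {i} \<times> {(j - 1) * k i + 1..j * k i})"

text \<open>The other end of edge \<open>v\<close>, that is, the next vertex around the cycle. It
  encodes the graph as a permutation of one index set.\<close>

definition cyc_succ :: "(nat \<Rightarrow> nat) \<Rightarrow> nat \<times> nat \<Rightarrow> nat \<times> nat" where
  "cyc_succ k = (\<lambda>(i, l). (i, if k i dvd l then l - k i + 1 else l + 1))"

lemma cyc_edge_conv_cyc_succ: "cyc_edge k v = {v, cyc_succ k v}"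
  by (cases v) (simp add: cyc_edge_def cyc_succ_def)

lemma finite_cyc_block [simp]: "finite (cyc_block k p)"
  by (cases p) (simp add: cyc_block_def)

lemma card_cyc_block: "1 \<le> j \<Longrightarrow> card (cyc_block k (i, j)) = k i"
  by (cases j) (auto simp: cyc_block_def card_cartesian_product)

text \<open>Parametrises a cycle by positions counted from 0, the form used in the lemmas on odd
  cycles.\<close>

lemma cyc_block_conv_image:
  assumes "1 \<le> j"
  shows "cyc_block k (i, j) = (\<lambda>s. (i, (j - 1) * k i + 1 + s)) ` {..<k i}"
proof -
  have "{(j - 1) * k i + 1..j * k i} = (\<lambda>s. (j - 1) * k i + 1 + s) ` {..<k i}"
  proof (intro equalityI subsetI)
    fix l assume "l \<in> {(j - 1) * k i + 1..j * k i}"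
    then show "l \<in> (\<lambda>s. (j - 1) * k i + 1 + s) ` {..<k i}"
      using assms by (intro image_eqI[of _ _ "l - ((j - 1) * k i + 1)"])
        (cases j; auto)+
  qed (use assms in \<open>cases j; auto\<close>)
  then show ?thesis
    by (auto simp: cyc_block_def)
qed

lemma cyc_succ_inner:
  assumes "s + 1 < k i"
  shows "cyc_succ k (i, (j - 1) * k i + 1 + s) = (i, (j - 1) * k i + 1 + (s + 1))"
proof -
  have "\<not> k i dvd (j - 1) * k i + (s + 1)"
    using assms by (subst dvd_add_right_iff) (auto dest: dvd_imp_le)
  then show ?thesis
    by (simp add: cyc_succ_def)
qed

lemma cyc_succ_last:
  assumes "1 \<le> j" "k i > 0"
  shows "cyc_succ k (i, (j - 1) * k i + 1 + (k i - 1)) = (i, (j - 1) * k i + 1)"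
  using assms by (simp add: cyc_succ_def)

lemma cyc_succ_in_block:
  assumes "1 \<le> j" "v \<in> cyc_block k (i, j)"
  shows "cyc_succ k v \<in> cyc_block k (i, j)"
proof -
  obtain s where s: "s < k i" "v = (i, (j - 1) * k i + 1 + s)"
    using assms by (auto simp: cyc_block_conv_image)
  show ?thesis
  proof (cases "s + 1 < k i")
    case True
    then show ?thesis
      unfolding s(2) cyc_succ_inner[of s k i j, OF True] using assms(1) by (auto simp: cyc_block_conv_image)
  next
    case False
    with s(1) have "s = k i - 1" "k i > 0" by auto
    then show ?thesis
      unfolding s(2) using cyc_succ_last[of j k i] assms(1) by (auto simp: cyc_block_conv_image)
  qed
qed

lemma cyc_index_conv_blocks:
  assumes "\<And>i. i \<in> {1..r} \<Longrightarrow> k i > 0"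
  shows "cyc_index r k m = (\<Union>p\<in>(SIGMA i:{1..r}. {1..m i}). cyc_block k p)"
proof (intro equalityI subsetI)
  fix v assume "v \<in> cyc_index r k m"
  then obtain i l where v: "v = (i, l)" "i \<in> {1..r}" "1 \<le> l" "l \<le> k i * m i"
    by (auto simp: cyc_index_def)
  have "k i > 0" using assms v by blast
  \<comment> \<open>Both \<open>l\<close> and \<open>j\<close> count from 1, hence the two
    shifts.\<close>
  define j where "j = (l - 1) div k i + 1"
  have "(l - 1) div k i < m i"
    using v \<open>k i > 0\<close> by (intro less_mult_imp_div_less) (auto simp: mult.commute)
  moreover have "(j - 1) * k i + 1 \<le> l" "l \<le> j * k i"
    using v times_div_less_eq_dividend[of "k i" "l - 1"] dividend_less_div_times[OF \<open>k i > 0\<close>, of "l - 1"]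
    by (auto simp: j_def algebra_simps simp del: times_div_less_eq_dividend)
  ultimately show "v \<in> (\<Union>p\<in>(SIGMA i:{1..r}. {1..m i}). cyc_block k p)"
    using v by (intro UN_I[of "(i, j)"]) (auto simp: cyc_block_def j_def)
next
  fix v assume "v \<in> (\<Union>p\<in>(SIGMA i:{1..r}. {1..m i}). cyc_block k p)"
  then obtain i j l where v: "v = (i, l)" "i \<in> {1..r}" "j \<le> m i" "(j - 1) * k i + 1 \<le> l" "l \<le> j * k i"
    by (auto simp: cyc_block_def)
  have "l \<le> m i * k i"
    using v(5) mult_le_mono1[OF v(3), of "k i"] by (rule le_trans)
  with v show "v \<in> cyc_index r k m"
    by (auto simp: cyc_index_def mult.commute)
qed

lemma cyc_block_disjoint:
  assumes "1 \<le> snd p" "1 \<le> snd p'" "p \<noteq> p'"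
  shows "cyc_block k p \<inter> cyc_block k p' = {}"
proof -
  have ordered: False if "j < j'" "l \<le> j * k i" "(j' - 1) * k i + 1 \<le> l" for i j j' l
  proof -
    have "j * k i \<le> (j' - 1) * k i" using that by (intro mult_le_mono1) simp
    with that show False by simp
  qed
  obtain i j i' j' where p: "p = (i, j)" "p' = (i', j')" by fastforce
  show ?thesis
  proof (cases "i = i'")
    case True
    then have "j < j' \<or> j' < j" using assms(3) p by auto
    then show ?thesis
      using ordered True by (fastforce simp: p cyc_block_def)
  qed (auto simp: p cyc_block_def)
qed

text \<open>An injective self-map of a finite set is bijective. This covers single cycles as well as
  the whole graph.\<close>

lemma bij_betw_cyc_succ:
  assumes "finite A" and maps: "cyc_succ k ` A \<subseteq> A" and pos: "\<And>v. v \<in> A \<Longrightarrow> snd v > 0"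
  shows "bij_betw (cyc_succ k) A A"
proof -
  \<comment> \<open>A wrapped-around value minus 1 is a multiple of \<open>k i\<close>, while an
    ordinary successor minus 1 is not, so the two branches never collide.\<close>
  have mixed: False if "k i dvd l" "\<not> k i dvd l'" "l > 0" "l - k i + 1 = l' + 1" for i l l'
    using that by (metis add_right_cancel dvd_diff_nat dvd_refl)
  have "inj_on (cyc_succ k) A"
  proof (rule inj_onI)
    fix v w assume vw: "v \<in> A" "w \<in> A" "cyc_succ k v = cyc_succ k w"
    obtain i l where v: "v = (i, l)" by fastforce
    obtain l' where w: "w = (i, l')" using vw(3) by (cases w) (auto simp: v cyc_succ_def)
    have "l > 0" "l' > 0" using pos[OF vw(1)] pos[OF vw(2)] by (auto simp: v w)
    have "k i \<le> l" if "k i dvd l" using that \<open>l > 0\<close> by (rule dvd_imp_le)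
    moreover have "k i \<le> l'" if "k i dvd l'" using that \<open>l' > 0\<close> by (rule dvd_imp_le)
    ultimately have "l = l'"
      using vw(3) mixed[of i l l'] mixed[of i l' l] \<open>l > 0\<close> \<open>l' > 0\<close>
      by (auto simp: v w cyc_succ_def split: if_splits)
    then show "v = w" by (simp add: v w)
  qed
  with assms show ?thesis
    by (simp add: bij_betw_def endo_inj_surj)
qed

text \<open>Moves the products from edge numbers within one graph to pairs, so that results about an
  arbitrary set of variables apply.\<close>

lemma cyc_binomials_conv_block:
  "cyc_binomials q k \<gamma> i j =
     {(\<Prod>v\<in>B. Var v ^ ((q - 1) div 2)) - (\<Prod>v\<in>cyc_block k (i, j) - B. Var v ^ ((q - 1) div 2)) | B.
      B \<subseteq> cyc_block k (i, j) \<and> card B = \<gamma> i}" (is "?L = ?R")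
proof -
  have prod: "(\<Prod>v\<in>Pair i ` B. Var v ^ n) = (\<Prod>\<alpha>\<in>B. Var (i, \<alpha>) ^ n)" for B n
    by (subst prod.reindex) (auto intro: inj_onI)
  have block: "cyc_block k (i, j) = Pair i ` {(j - 1) * k i + 1..j * k i}"
    by (auto simp: cyc_block_def)
  have diff: "Pair i ` A - Pair i ` B = Pair i ` (A - B)" for A B :: "nat set"
    by auto
  show ?thesis
  proof (intro equalityI subsetI)
    fix g assume "g \<in> ?L"
    then obtain B where "B \<subseteq> {(j - 1) * k i + 1..j * k i}" "card B = \<gamma> i"
      "g = (\<Prod>\<alpha>\<in>B. Var (i, \<alpha>) ^ ((q - 1) div 2)) -
      (\<Prod>w\<in>{(j - 1) * k i + 1..j * k i} - B. Var (i, w) ^ ((q - 1) div 2))"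
      unfolding cyc_binomials_def by blast
    then show "g \<in> ?R"
      unfolding block mem_Collect_eq
      by (intro exI[of _ "Pair i ` B"]) (auto simp: diff prod card_image inj_on_def)
  next
    fix g assume "g \<in> ?R"
    then obtain B' where B': "B' \<subseteq> cyc_block k (i, j)" "card B' = \<gamma> i"
      "g = (\<Prod>v\<in>B'. Var v ^ ((q - 1) div 2)) - (\<Prod>v\<in>cyc_block k (i, j) - B'. Var v ^ ((q - 1) div 2))"
      by blast
    from B'(1) obtain B where "B \<subseteq> {(j - 1) * k i + 1..j * k i}" "B' = Pair i ` B"
      unfolding block by (auto elim: subset_imageE)
    with B' show "g \<in> ?L"
      unfolding cyc_binomials_def mem_Collect_eq block
      by (intro exI[of _ B]) (auto simp: diff prod card_image inj_on_def)
  qed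
qed

section \<open>Leading monomials of the generators\<close>

lemma lookup_sum_single_const:
  "finite B \<Longrightarrow> Poly_Mapping.lookup (\<Sum>v\<in>B. Poly_Mapping.single v n) u = (if u \<in> B then n else 0)"
  by (simp add: lookup_sum lookup_single when_def)

lemma keys_sum_single_const:
  "finite B \<Longrightarrow> Poly_Mapping.keys (\<Sum>v\<in>B. Poly_Mapping.single v n) \<subseteq> B"
  by (auto simp: in_keys_iff lookup_sum_single_const split: if_splits)

lemma total_deg_sum_single_const:
  "finite B \<Longrightarrow> total_deg (\<Sum>v\<in>B. Poly_Mapping.single v n) = card B * n"
  by (simp add: total_deg_superset[OF _ keys_sum_single_const] lookup_sum_single_const)

lemma prod_Var_power_in_carrier:
  "finite B \<Longrightarrow> B \<subseteq> V \<Longrightarrow> (\<Prod>v\<in>B. Var v ^ n) \<in> carrier (mpoly_ring V)"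
  using keys_sum_single_const[of B n] by (auto simp: prod_Var_power mpoly_ring_def)

lemma diff_in_carrier_mpoly_ring:
  "f \<in> carrier (mpoly_ring V) \<Longrightarrow> g \<in> carrier (mpoly_ring V) \<Longrightarrow> f - g \<in> carrier (mpoly_ring V)"
  using keys_diff[of f g] by (auto simp: mpoly_ring_def)

lemma Var_power_minus_1:
  fixes v :: 'v
  assumes "n > 0"
  defines "f \<equiv> (Var v ^ n - 1 :: ('v, 'a::comm_ring_1) mpol)"
  shows "f \<noteq> 0" "lead_mon (grlex_less V ord) f = Poly_Mapping.single v n"
proof -
  have f: "f = Poly_Mapping.single (Poly_Mapping.single v n) 1 + Poly_Mapping.single 0 (- 1)"
    by (simp add: f_def Var_power single_uminus)
  have "total_deg (0 :: 'v \<Rightarrow>\<^sub>0 nat) < total_deg (Poly_Mapping.single v n)"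
    using assms(1) by (simp add: total_deg_def)
  then show "f \<noteq> 0" "lead_mon (grlex_less V ord) f = Poly_Mapping.single v n"
    unfolding f by (intro lead_mon_grlex_binomial; simp)+
qed

lemma prod_Var_power_diff:
  assumes "finite B" "finite D" "card B < card D" "n > 0"
  defines "f \<equiv> ((\<Prod>v\<in>B. Var v ^ n) - (\<Prod>v\<in>D. Var v ^ n) :: ('v, 'a::comm_ring_1) mpol)"
  shows "f \<noteq> 0" "lead_mon (grlex_less V ord) f = (\<Sum>v\<in>D. Poly_Mapping.single v n)"
proof -
  have f: "f = Poly_Mapping.single (\<Sum>v\<in>D. Poly_Mapping.single v n) (- 1) +
      Poly_Mapping.single (\<Sum>v\<in>B. Poly_Mapping.single v n) 1"
    using assms(1,2) by (simp add: f_def prod_Var_power single_uminus)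
  have "total_deg (\<Sum>v\<in>B. Poly_Mapping.single v n) < total_deg (\<Sum>v\<in>D. Poly_Mapping.single v n)"
    using assms(1-4) by (simp add: total_deg_sum_single_const)
  then show "f \<noteq> 0" "lead_mon (grlex_less V ord) f = (\<Sum>v\<in>D. Poly_Mapping.single v n)"
    unfolding f by (intro lead_mon_grlex_binomial; simp)+
qed

section \<open>The generators vanish on the toric set\<close>

lemma toric_setE:
  assumes "p \<in> toric_set V E ends"
  obtains x where "\<And>v. v \<in> V \<Longrightarrow> x v \<noteq> 0" "\<And>e. e \<in> E \<Longrightarrow> p e = (\<Prod>v\<in>ends e. x v)"
proof -
  obtain x where "p = (\<lambda>e\<in>E. \<Prod>v\<in>ends e. x v)" "x \<in> V \<rightarrow> UNIV - {0}"
    using assms unfolding toric_set_def by blast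
  then show ?thesis
    by (intro that[of x]) auto
qed

lemma Var_power_minus_1_in_vanishing_ideal:
  fixes X :: "('v \<Rightarrow> 'a::{field,finite}) set"
  assumes "v \<in> V" and "\<And>p. p \<in> X \<Longrightarrow> p v \<noteq> 0"
  shows "Var v ^ (card (UNIV :: 'a set) - 1) - 1 \<in> vanishing_ideal V X"
proof -
  have "Var v ^ (card (UNIV :: 'a set) - 1) - 1 \<in> carrier (mpoly_ring V :: ('v, 'a) mpol ring)"
    using assms(1) by (intro diff_in_carrier_mpoly_ring) (auto simp: Var_power mpoly_ring_def split: if_splits)
  then show ?thesis
    using assms(2)
    by (simp add: vanishing_ideal_def mpol_eval_diff mpol_eval_power mpol_eval_Var
        finite_field_power_card_minus_1 del: One_nat_def)
qed

text \<open>The product of the coordinates over a cycle is the square of the product of its vertex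
  variables, so its \<open>h\<close>-th power is 1, while the \<open>h\<close>-th power of every coordinate is its own
  inverse.\<close>

lemma cycle_binomial_in_vanishing_ideal:
  fixes X :: "('v \<Rightarrow> 'a::{field,finite}) set"
  assumes h: "2 * h = card (UNIV :: 'a set) - 1"
    and C: "finite C" "C \<subseteq> V" "bij_betw s C C" and "B \<subseteq> C"
    and X: "\<And>p. p \<in> X \<Longrightarrow> \<exists>x. (\<forall>v\<in>C. x v \<noteq> 0) \<and> (\<forall>v\<in>C. p v = x v * x (s v))"
  shows "(\<Prod>v\<in>B. Var v ^ h) - (\<Prod>v\<in>C - B. Var v ^ h) \<in> vanishing_ideal V X"
proof -
  have fin: "finite B" "finite (C - B)" using \<open>B \<subseteq> C\<close> \<open>finite C\<close> by (auto intro: finite_subset)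
  have "(\<Prod>v\<in>B. p v ^ h) = (\<Prod>v\<in>C - B. p v ^ h)" if p: "p \<in> X" for p
  proof -
    obtain x where x: "\<And>v. v \<in> C \<Longrightarrow> x v \<noteq> 0" "\<And>v. v \<in> C \<Longrightarrow> p v = x v * x (s v)"
      using X[OF p] by blast
    have sq: "y ^ h * y ^ h = 1" if "y \<noteq> 0" for y :: 'a
      using finite_field_power_card_minus_1[OF that] by (simp only: h flip: power_add mult_2)
    have "(\<Prod>v\<in>B. p v ^ h) * (\<Prod>v\<in>C - B. p v ^ h) = (\<Prod>v\<in>C. p v ^ h)"
      using prod.subset_diff[OF \<open>B \<subseteq> C\<close> \<open>finite C\<close>, of "\<lambda>v. p v ^ h"] by (simp add: mult.commute)
    also have "\<dots> = (\<Prod>v\<in>C. x v ^ h) * (\<Prod>v\<in>C. x (s v) ^ h)"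
      by (simp add: x(2) power_mult_distrib prod.distrib)
    also have "(\<Prod>v\<in>C. x (s v) ^ h) = (\<Prod>v\<in>C. x v ^ h)"
      by (rule prod.reindex_bij_betw[OF C(3)])
    also have "(\<Prod>v\<in>C. x v ^ h) * (\<Prod>v\<in>C. x v ^ h) = 1"
      using x(1) by (simp add: sq flip: prod.distrib)
    finally have inv: "(\<Prod>v\<in>B. p v ^ h) * (\<Prod>v\<in>C - B. p v ^ h) = 1" .
    have "p v \<noteq> 0" if "v \<in> C" for v
      using x that bij_betwE[OF C(3)] by auto
    then have "(\<Prod>v\<in>C - B. p v ^ h) * (\<Prod>v\<in>C - B. p v ^ h) = 1"
      by (simp add: sq flip: prod.distrib)
    \<comment> \<open>The second product is inverse to the first and also to itself; cancelling it
      makes the two equal.\<close>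
    with inv have "(\<Prod>v\<in>B. p v ^ h) * (\<Prod>v\<in>C - B. p v ^ h) =
        (\<Prod>v\<in>C - B. p v ^ h) * (\<Prod>v\<in>C - B. p v ^ h)"
      by (rule trans[OF _ sym])
    moreover have "(\<Prod>v\<in>C - B. p v ^ h) \<noteq> 0"
      using inv by (metis mult_zero_right zero_neq_one)
    ultimately show ?thesis
      by (metis mult_right_cancel)
  qed
  moreover have "(\<Prod>v\<in>B. Var v ^ h) - (\<Prod>v\<in>C - B. Var v ^ h) \<in> carrier (mpoly_ring V :: ('v, 'a) mpol ring)"
    using fin \<open>B \<subseteq> C\<close> C by (intro diff_in_carrier_mpoly_ring prod_Var_power_in_carrier) auto
  ultimately show ?thesis
    by (simp add: vanishing_ideal_def mpol_eval_diff mpol_eval_prod mpol_eval_power mpol_eval_Var)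
qed

theorem proposition4p1:
  fixes r :: nat
    and m \<gamma> k :: "nat \<Rightarrow> nat"
    and q :: nat
    and ord :: "((nat \<times> nat) \<times> (nat \<times> nat)) set"
    and G :: "(nat \<times> nat, 'a::{field,finite}) mpol set"
  assumes "q = card (UNIV :: 'a set)"
    and "odd q"
    and "r \<ge> 1"
    and "\<And>i. i \<in> {1..r} \<Longrightarrow> m i \<ge> 1"
    and "\<And>i. i \<in> {1..r} \<Longrightarrow> \<gamma> i \<ge> 1"
    and "\<And>i. i \<in> {1..r} \<Longrightarrow> k i = 2 * \<gamma> i + 1"
    and "linear_order_on (cyc_index r k m) ord"
    and "G = (\<Union>i\<in>{1..r}. {Var (i, j) ^ (q - 1) - 1 | j. j \<in> {1..k i * m i}}) \<union>
             (\<Union>i\<in>{1..r}. \<Union>j\<in>{1..m i}. cyc_binomials q k \<gamma> i j)"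
  shows "groebner_basis (cyc_index r k m) (grlex_less (cyc_index r k m) ord) G
           (vanishing_ideal (cyc_index r k m) (cyc_toric_set r k m))"
proof -
  define V where "V = cyc_index r k m"
  define P where "P = (SIGMA i:{1..r}. {1..m i})"
  define X :: "(nat \<times> nat \<Rightarrow> 'a) set" where "X = cyc_toric_set r k m"
  define h where "h = (q - 1) div 2"
  have h: "2 * h = q - 1" "h > 0"
    using \<open>odd q\<close> card_field_ge_2[where 'a = 'a] assms(1) by (auto simp: h_def elim!: oddE)
  have kpos: "k i > 0" if "i \<in> {1..r}" for i
    using assms(6)[OF that] by simp
  have V: "V = (\<Union>p\<in>P. cyc_block k p)"
    unfolding V_def P_def by (rule cyc_index_conv_blocks) (rule kpos)
  have finP: "finite P" by (simp add: P_def)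
  then have finV: "finite V" by (simp add: V)
  have block: "finite (cyc_block k p)" "cyc_block k p \<subseteq> V" if "p \<in> P" for p
    using that by (auto simp: V)
  have pos: "snd v > 0" if "v \<in> V" for v
    using that by (auto simp: V_def cyc_index_def)
  have maps: "cyc_succ k ` cyc_block k p \<subseteq> cyc_block k p" if "p \<in> P" for p
    using that cyc_succ_in_block by (auto simp: P_def)
  have bij_block: "bij_betw (cyc_succ k) (cyc_block k p) (cyc_block k p)" if "p \<in> P" for p
    using that block[OF that] pos maps by (intro bij_betw_cyc_succ) auto
  have bij: "bij_betw (cyc_succ k) V V"
    using finV pos maps by (intro bij_betw_cyc_succ) (fastforce simp: V)+
  \<comment> \<open>Since \<open>k i \<ge> 2\<close>, no edge is a loop.\<close>
  have ends: "cyc_edge k e = {e, cyc_succ k e} \<and> cyc_succ k e \<noteq> e" if eV: "e \<in> V" for e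
  proof -
    obtain i l where e: "e = (i, l)" "i \<in> {1..r}" using eV by (auto simp: V_def cyc_index_def)
    then have "k i \<ge> 2" using assms(5,6)[of i] by simp
    then show ?thesis
      using pos[OF eV] by (auto simp: cyc_edge_conv_cyc_succ cyc_succ_def e dest: dvd_imp_le)
  qed
  have X_eq: "X = toric_set V V (cyc_edge k)"
    by (simp add: X_def V_def cyc_toric_set_def)
  have point: "\<exists>x. (\<forall>v\<in>V. x v \<noteq> 0) \<and> (\<forall>v\<in>V. p v = x v * x (cyc_succ k v))" if pX: "p \<in> X" for p
  proof -
    obtain x where x: "\<And>v. v \<in> V \<Longrightarrow> x v \<noteq> 0" "\<And>e. e \<in> V \<Longrightarrow> p e = (\<Prod>v\<in>cyc_edge k e. x v)"
      using pX unfolding X_eq by (rule toric_setE) (rule that)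
    have "p e = x e * x (cyc_succ k e)" if "e \<in> V" for e
      using ends[OF that] x(2)[OF that] prod.insert[of "{cyc_succ k e}" e x] by auto
    with x(1) show ?thesis by blast
  qed
  \<comment> \<open>Both families of generators are reindexed, by variables and by cycles.\<close>
  have "(\<Union>i\<in>{1..r}. {Var (i, j) ^ (q - 1) - 1 | j. j \<in> {1..k i * m i}}) =
      (\<lambda>v. Var v ^ (q - 1) - 1 :: (nat \<times> nat, 'a) mpol) ` V"
    unfolding V_def cyc_index_def image_def by blast
  moreover have "(\<Union>i\<in>{1..r}. \<Union>j\<in>{1..m i}. cyc_binomials q k \<gamma> i j) =
      (\<Union>(i, j)\<in>P. cyc_binomials q k \<gamma> i j :: (nat \<times> nat, 'a) mpol set)"
    unfolding P_def by auto
  ultimately have G: "G = (\<lambda>v. Var v ^ (q - 1) - 1) ` V \<union> (\<Union>(i, j)\<in>P. cyc_binomials q k \<gamma> i j)"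
    by (simp only: assms(8))
  have "finite (cyc_binomials q k \<gamma> i j :: (nat \<times> nat, 'a) mpol set)" for i j
    by (simp add: cyc_binomials_conv_block)
  then have "finite G"
    using finV finP by (auto simp: G)
  have "G \<subseteq> vanishing_ideal V X"
  proof -
    have "Var v ^ (q - 1) - 1 \<in> vanishing_ideal V X" if "v \<in> V" for v
    proof -
      have "p v \<noteq> 0" if "p \<in> X" for p
        using point[OF that] \<open>v \<in> V\<close> bij_betwE[OF bij] by auto
      with \<open>v \<in> V\<close> show ?thesis
        unfolding assms(1) by (intro Var_power_minus_1_in_vanishing_ideal)
    qed
    moreover have "cyc_binomials q k \<gamma> i j \<subseteq> vanishing_ideal V X" if ij: "(i, j) \<in> P" for i j
    proof -
      have "\<exists>x. (\<forall>v\<in>cyc_block k (i, j). x v \<noteq> 0) \<and>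
          (\<forall>v\<in>cyc_block k (i, j). p v = x v * x (cyc_succ k v))" if "p \<in> X" for p
        using point[OF that] block[OF \<open>(i, j) \<in> P\<close>] by blast
      then show ?thesis
        using h block[OF ij] bij_block[OF ij] assms(1)
        unfolding cyc_binomials_conv_block h_def[symmetric]
        by (auto intro!: cycle_binomial_in_vanishing_ideal)
    qed
    ultimately show ?thesis unfolding G by blast
  qed
  moreover have "\<exists>g\<in>G - {0}. \<forall>v. Poly_Mapping.lookup (lead_mon (grlex_less V ord) g) v
      \<le> Poly_Mapping.lookup (lead_mon (grlex_less V ord) f) v"
    if f: "f \<in> vanishing_ideal V X" "f \<noteq> 0" for f
  proof (rule ccontr)
    assume "\<not> ?thesis"
    \<comment> \<open>No leading monomial of \<open>G\<close> divides that of \<open>f\<close>; each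
      use below exhibits one that would.\<close>
    then have reduced: False if "g \<in> G" "g \<noteq> 0"
      "\<And>v. Poly_Mapping.lookup (lead_mon (grlex_less V ord) g) v
        \<le> Poly_Mapping.lookup (lead_mon (grlex_less V ord) f) v" for g
      using that by blast
    define M where "M = lead_mon (grlex_less V ord) f"
    have fV: "f \<in> carrier (mpoly_ring V)"
      using f(1) by (simp add: vanishing_ideal_def)
    have ord: "linear_order_on V ord"
      using assms(7) by (simp add: V_def)
    have M: "M \<in> Poly_Mapping.keys f"
      unfolding M_def by (rule lead_mon_grlex_in_keys[OF finV ord fV f(2)])
    \<comment> \<open>Otherwise the leading monomial of \<open>Var v ^ (q - 1) - 1\<close> divides
      \<open>M\<close>.\<close>
    have small: "Poly_Mapping.lookup M v < 2 * h" if vV: "v \<in> V" for v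
    proof (rule ccontr)
      assume large: "\<not> Poly_Mapping.lookup M v < 2 * h"
      have "q - 1 > 0" using h by simp
      note * = Var_power_minus_1[OF this, where v = v and 'a = 'a]
      show False
      proof (rule reduced[OF _ *(1)])
        show "Var v ^ (q - 1) - 1 \<in> G" using vV by (simp add: G)
      qed (use large h in \<open>auto simp: *(2) lookup_single when_def simp del: One_nat_def simp flip: M_def\<close>)
    qed
    have few: "card {v \<in> cyc_block k (i, j). h \<le> Poly_Mapping.lookup M v} \<le> \<gamma> i"
      if ij: "(i, j) \<in> P" for i j
    proof (rule ccontr)
      let ?C = "cyc_block k (i, j)"
      assume "\<not> ?thesis"
      then have "\<gamma> i + 1 \<le> card {v \<in> ?C. h \<le> Poly_Mapping.lookup M v}" by simp
      then obtain D where D: "D \<subseteq> {v \<in> ?C. h \<le> Poly_Mapping.lookup M v}" "card D = \<gamma> i + 1"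
        "finite D"
        by (rule obtain_subset_with_card_n)
      have "card ?C = 2 * \<gamma> i + 1"
        using ij assms(6) by (simp add: P_def card_cyc_block)
      moreover have "D \<subseteq> ?C" using D(1) by blast
      ultimately have card: "card (?C - D) = \<gamma> i"
        using D by (simp add: card_Diff_subset)
      have CD: "?C - (?C - D) = D" using \<open>D \<subseteq> ?C\<close> by blast
      \<comment> \<open>The binomial for \<open>B = ?C - D\<close>. Its larger side is the product
        over the \<open>\<gamma> i + 1\<close> elements of \<open>D\<close>, where \<open>M\<close>
        has exponents at least \<open>h\<close>, so it divides \<open>M\<close>.\<close>
      define g :: "(nat \<times> nat, 'a) mpol"
        where "g = (\<Prod>v\<in>?C - D. Var v ^ h) - (\<Prod>v\<in>D. Var v ^ h)"
      have "g \<in> cyc_binomials q k \<gamma> i j"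
        unfolding cyc_binomials_conv_block g_def h_def[symmetric] mem_Collect_eq
        by (intro exI[of _ "?C - D"]) (simp add: CD card)
      with ij have "g \<in> G" by (auto simp: G)
      have *: "g \<noteq> 0" "lead_mon (grlex_less V ord) g = (\<Sum>v\<in>D. Poly_Mapping.single v h)"
        unfolding g_def by (rule prod_Var_power_diff; use D card h in simp)+
      show False
        by (rule reduced[OF \<open>g \<in> G\<close> *(1)])
          (use D in \<open>auto simp: *(2) lookup_sum_single_const simp flip: M_def\<close>)
    qed
    obtain M' where M': "M' \<in> Poly_Mapping.keys f" "M' \<noteq> M"
      and dvd: "\<And>e. e \<in> V \<Longrightarrow> int (2 * h) dvd
        (int (Poly_Mapping.lookup M' e) - int (Poly_Mapping.lookup M e)) +
        (int (Poly_Mapping.lookup M' (cyc_succ k e)) - int (Poly_Mapping.lookup M (cyc_succ k e)))"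
      using vanishing_ideal_toric_set_other_monomial[OF finV bij ends f(1)[unfolded X_eq] M]
      unfolding h(1) assms(1) by blast
    have keys: "Poly_Mapping.keys M \<subseteq> V" "Poly_Mapping.keys M' \<subseteq> V"
      using fV M M'(1) by (auto simp: mpoly_ring_def)
    have cases: "sum (Poly_Mapping.lookup M) (cyc_block k p) < sum (Poly_Mapping.lookup M') (cyc_block k p) \<or>
        (\<forall>v\<in>cyc_block k p. Poly_Mapping.lookup M v \<le> Poly_Mapping.lookup M' v)" if p: "p \<in> P" for p
    proof -
      obtain i j where ij: "p = (i, j)" "i \<in> {1..r}" "1 \<le> j" using p by (auto simp: P_def)
      define v where "v s = (i, (j - 1) * k i + 1 + s)" for s
      \<comment> \<open>The change of exponents from \<open>M\<close> to \<open>M'\<close>; along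
        the cycle it satisfies the congruences of an odd cycle modulo \<open>q - 1\<close>.\<close>
      define d where "d u = int (Poly_Mapping.lookup M' u) - int (Poly_Mapping.lookup M u)" for u
      have img: "cyc_block k p = v ` {..<k i}"
        using cyc_block_conv_image[OF ij(3)] by (simp add: ij(1) v_def)
      then have dvd': "int (2 * h) dvd d (v s) + d (cyc_succ k (v s))" if "s < k i" for s
        using dvd[of "v s"] block[OF p] that by (auto simp: d_def)
      have "(\<forall>s<k i. int (2 * h) dvd d (v s)) \<or> (\<forall>s<k i. int (2 * h) dvd d (v s) - int h)"
      proof (rule odd_cycle_exponent_dichotomy)
        show "odd (k i)" using assms(6)[OF ij(2)] by simp
        show "int (2 * h) dvd d (v s) + d (v (s + 1))" if "s + 1 < k i" for s
          using dvd'[of s] cyc_succ_inner[of s k i j, OF that] that by (simp add: v_def)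
        show "int (2 * h) dvd d (v (k i - 1)) + d (v 0)"
          using dvd'[of "k i - 1"] cyc_succ_last[of j k i] kpos[OF ij(2)] ij(3) by (simp add: v_def)
      qed
      then have "(\<forall>u\<in>cyc_block k p. int (2 * h) dvd d u) \<or>
          (\<forall>u\<in>cyc_block k p. int (2 * h) dvd d u - int h)"
        unfolding img by blast
      moreover have "card (cyc_block k p) = 2 * \<gamma> i + 1"
        using card_cyc_block[OF ij(3), of k i] assms(6)[OF ij(2)] by (simp add: ij(1))
      moreover have "card {v \<in> cyc_block k p. h \<le> Poly_Mapping.lookup M v} \<le> \<gamma> i"
        using few[of i j] p by (simp add: ij(1))
      ultimately show ?thesis
        unfolding d_def using small block[OF p] h(2)
        by (intro reduced_exponents_minimal) auto
    qed
    then have le: "sum (Poly_Mapping.lookup M) (cyc_block k p) \<le> sum (Poly_Mapping.lookup M') (cyc_block k p)"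
      if "p \<in> P" for p
      using that by (meson less_imp_le sum_mono)
    \<comment> \<open>The cycles partition the variables, so degrees can be compared cycle by
      cycle.\<close>
    have deg: "total_deg n = (\<Sum>p\<in>P. sum (Poly_Mapping.lookup n) (cyc_block k p))"
      if "Poly_Mapping.keys n \<subseteq> V" for n
      unfolding total_deg_superset[OF finV that] unfolding V using finP
      by (intro sum.UNION_disjoint ballI impI cyc_block_disjoint) (auto simp: P_def)
    have "grlex_less V ord M' M"
      using lead_mon_grlex_greatest[OF finV ord fV f(2) M'(1)] M'(2) by (simp add: M_def)
    then have "total_deg M' \<le> total_deg M"
      by (auto simp: grlex_less_def)
    \<comment> \<open>On no cycle does \<open>M'\<close> have smaller degree, and in total it cannot
      have larger degree because \<open>M\<close> is leading.\<close>
    then have deg_eq: "(\<Sum>p\<in>P. sum (Poly_Mapping.lookup M) (cyc_block k p)) =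
        (\<Sum>p\<in>P. sum (Poly_Mapping.lookup M') (cyc_block k p))"
      using sum_mono[OF le] deg[OF keys(1)] deg[OF keys(2)] by (intro antisym) auto
    have "Poly_Mapping.lookup M v = Poly_Mapping.lookup M' v" for v
    proof (cases "v \<in> V")
      case True
      then obtain p where p: "p \<in> P" "v \<in> cyc_block k p" by (auto simp: V)
      \<comment> \<open>Termwise inequality with equal totals forces equality on every cycle. This
        excludes the strict alternative in \<open>cases\<close>, and the same argument inside the
        cycle equates the exponents.\<close>
      have eq: "sum (Poly_Mapping.lookup M) (cyc_block k p) = sum (Poly_Mapping.lookup M') (cyc_block k p)"
        by (rule sum_mono_inv[OF deg_eq le p(1) finP])
      then show ?thesis
        using cases[OF p(1)] p(2) by (intro sum_mono_inv[OF eq]) auto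
    next
      case False
      with keys show ?thesis by (metis in_keys_iff subsetD)
    qed
    then have "M = M'" by (rule poly_mapping_eqI)
    with M'(2) show False by simp
  qed
  ultimately have "groebner_basis V (grlex_less V ord) G (vanishing_ideal V X)"
    using finV assms(7) \<open>finite G\<close> ideal_vanishing_ideal
    by (intro groebner_basis_grlexI) (auto simp: V_def)
  then show ?thesis by (simp add: V_def X_def)
qed

end
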